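(* Let $\Omega$ be a bounded domain in $\mathbb{C}^m$ and let $K:\Omega\times\Omega\to\mathbb{C}$ be a sesqui-analytic function for which a continuous branch of $\log K$ exists on $\Omega\times\Omega$. Suppose that $K^\alpha$ and $K^\beta$, defined on $\Omega\times\Omega$, are non-negative definite for some $\alpha,\beta>0$. Then the function $$(z,w)\longmapsto K^{\alpha+\beta}(z,w)\Big(\big(\partial_i\bar\partial_j\log K\big)(z,w)\Big)_{i,j=1}^m,\qquad z,w\in\Omega,$$ is a non-negative definite kernel on $\Omega\times\Omega$ taking values in $\mathcal{M}_m(\mathbb{C})$.
   Context: A function on $\Omega\times\Omega$ is sesqui-analytic if it is holomorphic in the first $m$ variables and anti-holomorphic in the second $m$ variables. For a continuous branch of $\log K$ on $\Omega\times\Omega$ and real $t$, $K^t(z,w):=\exp(t\log K(z,w))$. The symbols $\partial_i$ and $\bar\partial_j$ denote $\frac{\partial}{\partial z_i}$ and $\frac{\partial}{\partial\bar w_j}$. A function $L:\Omega\times\Omega\to\mathcal{M}_k(\mathbb{C})$ ($k\times k$ complex matrices) is a non-negative definite kernel if $\sum_{p,q=1}^n\langle L(z_p,z_q)\eta_q,\eta_p\rangle_{\mathbb{C}^k}\ge 0$ for all $n$, all $z_1,\dots,z_n\in\Omega$ and all $\eta_1,\dots,\eta_n\in\mathbb{C}^k$. *)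

theory Defs
  imports "HOL-Complex_Analysis.Complex_Analysis"
begin

text \<open>
  Holomorphy on an open subset of \<open>\<complex>\<^sup>m\<close>: real Frechet differentiability at every point,
  with complex-linear derivative (\<open>complex ^ 'm\<close> is only a real vector space in the
  library's type classes).
\<close>

definition holomorphic_vec_on :: "(complex ^ 'm \<Rightarrow> complex) \<Rightarrow> (complex ^ 'm) set \<Rightarrow> bool" where
  "holomorphic_vec_on f \<Omega> \<longleftrightarrow>
     (\<forall>z\<in>\<Omega>. \<exists>D. (f has_derivative D) (at z) \<and> (\<forall>c v. D (c *s v) = c * D v))"

definition antiholomorphic_vec_on :: "(complex ^ 'm \<Rightarrow> complex) \<Rightarrow> (complex ^ 'm) set \<Rightarrow> bool" where
  "antiholomorphic_vec_on f \<Omega> \<longleftrightarrow> holomorphic_vec_on (\<lambda>w. cnj (f w)) \<Omega>"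

definition sesqui_analytic_on ::
  "(complex ^ 'm) set \<Rightarrow> (complex ^ 'm \<Rightarrow> complex ^ 'm \<Rightarrow> complex) \<Rightarrow> bool" where
  "sesqui_analytic_on \<Omega> K \<longleftrightarrow>
     (\<forall>w\<in>\<Omega>. holomorphic_vec_on (\<lambda>z. K z w) \<Omega>) \<and>
     (\<forall>z\<in>\<Omega>. antiholomorphic_vec_on (\<lambda>w. K z w) \<Omega>)"

definition continuous_log_branch_on ::
  "(complex ^ 'm) set \<Rightarrow> (complex ^ 'm \<Rightarrow> complex ^ 'm \<Rightarrow> complex) \<Rightarrow>
   (complex ^ 'm \<Rightarrow> complex ^ 'm \<Rightarrow> complex) \<Rightarrow> bool" where
  "continuous_log_branch_on \<Omega> K logK \<longleftrightarrow>
     continuous_on (\<Omega> \<times> \<Omega>) (\<lambda>(z, w). logK z w) \<and>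
     (\<forall>z\<in>\<Omega>. \<forall>w\<in>\<Omega>. exp (logK z w) = K z w)"

text \<open>The power \<open>K\<^sup>t\<close> depends on the chosen branch of \<open>log K\<close>, so the branch is the argument.\<close>

definition kernel_power ::
  "('a \<Rightarrow> 'a \<Rightarrow> complex) \<Rightarrow> real \<Rightarrow> 'a \<Rightarrow> 'a \<Rightarrow> complex" where
  "kernel_power logK t z w = exp (complex_of_real t * logK z w)"

text \<open>
  Wirtinger derivatives
  \<open>\<partial>/\<partial>z\<^sub>i = (\<partial>/\<partial>x\<^sub>i - \<i> \<partial>/\<partial>y\<^sub>i) / 2\<close> and
  \<open>\<partial>/\<partial>\<bar>z\<^sub>i = (\<partial>/\<partial>x\<^sub>i + \<i> \<partial>/\<partial>y\<^sub>i) / 2\<close>, where \<open>z\<^sub>i = x\<^sub>i + \<i> y\<^sub>i\<close>.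
\<close>

definition partial_re :: "'m \<Rightarrow> (complex ^ 'm \<Rightarrow> complex) \<Rightarrow> complex ^ 'm \<Rightarrow> complex" where
  "partial_re i f z = vector_derivative (\<lambda>t. f (z + axis i (complex_of_real t))) (at 0)"

definition partial_im :: "'m \<Rightarrow> (complex ^ 'm \<Rightarrow> complex) \<Rightarrow> complex ^ 'm \<Rightarrow> complex" where
  "partial_im i f z = vector_derivative (\<lambda>t. f (z + axis i (\<i> * complex_of_real t))) (at 0)"

definition wirtinger :: "'m \<Rightarrow> (complex ^ 'm \<Rightarrow> complex) \<Rightarrow> complex ^ 'm \<Rightarrow> complex" where
  "wirtinger i f z = (partial_re i f z - \<i> * partial_im i f z) / 2"

definition wirtinger_bar :: "'m \<Rightarrow> (complex ^ 'm \<Rightarrow> complex) \<Rightarrow> complex ^ 'm \<Rightarrow> complex" where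
  "wirtinger_bar i f z = (partial_re i f z + \<i> * partial_im i f z) / 2"

definition mixed_derivative ::
  "'m \<Rightarrow> 'm \<Rightarrow> (complex ^ 'm \<Rightarrow> complex ^ 'm \<Rightarrow> complex) \<Rightarrow> complex ^ 'm \<Rightarrow> complex ^ 'm \<Rightarrow> complex"
  where
  "mixed_derivative i j F z w = wirtinger i (\<lambda>z'. wirtinger_bar j (\<lambda>w'. F z' w') w) z"

text \<open>
  The library's inner product on \<open>complex ^ 'k\<close> is the real one; this is the Hermitian one,
  linear in the first argument.
\<close>

definition hermitian_inner :: "complex ^ 'k \<Rightarrow> complex ^ 'k \<Rightarrow> complex" where
  "hermitian_inner u v = (\<Sum>i\<in>UNIV. u $ i * cnj (v $ i))"

definition nonneg_definite_kernel_on ::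
  "'a set \<Rightarrow> ('a \<Rightarrow> 'a \<Rightarrow> complex ^ 'k ^ 'k) \<Rightarrow> bool" where
  "nonneg_definite_kernel_on \<Omega> L \<longleftrightarrow>
     (\<forall>(n::nat) (z :: nat \<Rightarrow> 'a) (\<eta> :: nat \<Rightarrow> complex ^ 'k). (\<forall>p<n. z p \<in> \<Omega>) \<longrightarrow>
        (\<Sum>p<n. \<Sum>q<n. hermitian_inner (L (z p) (z q) *v \<eta> q) (\<eta> p)) \<in> \<real>\<^sub>\<ge>\<^sub>0)"

text \<open>A scalar kernel is regarded as a kernel with values in the \<open>1 \<times> 1\<close> matrices.\<close>

definition nonneg_definite_scalar_kernel_on :: "'a set \<Rightarrow> ('a \<Rightarrow> 'a \<Rightarrow> complex) \<Rightarrow> bool" where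
  "nonneg_definite_scalar_kernel_on \<Omega> K \<longleftrightarrow>
     nonneg_definite_kernel_on \<Omega> (\<lambda>z w. mat (K z w) :: complex ^ 1 ^ 1)"

end

theory Submission
  imports Defs
begin

text \<open>
  Write \<open>K\<^sup>\<alpha>(z,w) = \<langle>k\<^sub>w, k\<^sub>z\<rangle>\<close> and \<open>K\<^sup>\<beta>(z,w) = \<langle>l\<^sub>w, l\<^sub>z\<rangle>\<close> with feature vectors \<open>k\<close>, \<open>l\<close> in
  Hilbert spaces. The theorem holds because the vectors
  \<open>u\<^sub>i(w) = \<beta> (\<partial>'\<^sub>i k\<^sub>w) \<otimes> l\<^sub>w - \<alpha> k\<^sub>w \<otimes> (\<partial>'\<^sub>i l\<^sub>w)\<close>
  have Gram matrix \<open>\<alpha> \<beta> (\<alpha> + \<beta>) K\<^sup>\<alpha>\<^sup>+\<^sup>\<beta> \<partial>\<^sub>i \<partial>'\<^sub>j log K\<close>, where \<open>\<partial>'\<^sub>j\<close> is the derivative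
  with respect to the conjugate of the \<open>j\<close>-th coordinate: the
  products of first derivatives of \<open>log K\<close> carry the coefficients
  \<open>\<alpha>\<^sup>2 \<beta>\<^sup>2 - 2 \<alpha>\<^sup>2 \<beta>\<^sup>2 + \<alpha>\<^sup>2 \<beta>\<^sup>2 = 0\<close>, and the mixed second derivative carries \<open>\<alpha> \<beta>\<^sup>2 + \<alpha>\<^sup>2 \<beta>\<close>.

  The proof below works with matrices only. The vector \<open>u\<^sub>i(w)\<close> is the derivative at \<open>0\<close> of
  \<open>h \<mapsto> k\<^bsub>w + \<beta> h e\<^sub>i\<^esub> \<otimes> l\<^bsub>w - \<alpha> h e\<^sub>i\<^esub>\<close>, so it is replaced by a difference quotient with a real step
  \<open>h\<close>. The Gram matrix of these quotients is positive semidefinite, since a tensor product of kernels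
  is a Schur product of matrices (\<open>psd_on_schur_product\<close>). Its entries are mixed second difference
  quotients of
  \<open>F(s,t) = exp (\<alpha> G(\<beta> s, \<beta> t) + \<beta> G(-\<alpha> s, -\<alpha> t))\<close>, where \<open>G(s,t) = log K(z + s e\<^sub>i, w + cnj t e\<^sub>j)\<close>,
  whose exponent has vanishing first derivatives at the origin; hence they converge to
  \<open>\<alpha> \<beta> (\<alpha> + \<beta>) K\<^sup>\<alpha>\<^sup>+\<^sup>\<beta> \<partial>\<^sub>i \<partial>'\<^sub>j log K\<close> (\<open>power_difference_limit\<close>), and positivity survives the limit.

  Convergence of a second difference quotient on the diagonal \<open>s = t = h\<close> needs some joint regularity.
  Separate holomorphy and local boundedness suffice: by Cauchy's estimates the error of the first
  difference quotient in \<open>t\<close> is uniformly small and holomorphic in \<open>s\<close>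
  (\<open>mixed_second_difference_limit\<close>). Both properties hold for \<open>log K\<close>, because a continuous
  logarithm of a holomorphic function is holomorphic.
\<close>

section \<open>Positive semidefinite matrices and Schur products\<close>

definition psd_on :: "'i set \<Rightarrow> ('i \<Rightarrow> 'i \<Rightarrow> complex) \<Rightarrow> bool" where
  "psd_on S A \<longleftrightarrow> (\<forall>c. (\<Sum>p\<in>S. \<Sum>q\<in>S. A p q * c q * cnj (c p)) \<in> \<real>\<^sub>\<ge>\<^sub>0)"

lemma psd_onD: "psd_on S A \<Longrightarrow> (\<Sum>p\<in>S. \<Sum>q\<in>S. A p q * c q * cnj (c p)) \<in> \<real>\<^sub>\<ge>\<^sub>0"
  by (simp add: psd_on_def)

lemma psd_on_subset:
  assumes "psd_on S A" "T \<subseteq> S" "finite S"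
  shows "psd_on T A"
  unfolding psd_on_def
proof
  fix c :: "'a \<Rightarrow> complex"
  define d where "d p = (if p \<in> T then c p else 0)" for p
  have "(\<Sum>p\<in>S. \<Sum>q\<in>S. A p q * d q * cnj (d p)) = (\<Sum>p\<in>T. \<Sum>q\<in>S. A p q * d q * cnj (d p))"
    using assms by (intro sum.mono_neutral_right) (auto simp: d_def)
  also have "\<dots> = (\<Sum>p\<in>T. \<Sum>q\<in>T. A p q * d q * cnj (d p))"
    using assms by (intro sum.cong sum.mono_neutral_right refl) (auto simp: d_def)
  also have "\<dots> = (\<Sum>p\<in>T. \<Sum>q\<in>T. A p q * c q * cnj (c p))"
    by (simp add: d_def)
  finally show "(\<Sum>p\<in>T. \<Sum>q\<in>T. A p q * c q * cnj (c p)) \<in> \<real>\<^sub>\<ge>\<^sub>0"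
    using psd_onD[OF assms(1), of d] by simp
qed

lemma psd_on_diagonal:
  assumes "psd_on S A" "finite S" "p \<in> S"
  shows "A p p \<in> \<real>\<^sub>\<ge>\<^sub>0"
  using psd_onD[OF psd_on_subset[OF assms(1), of "{p}"], of "\<lambda>_. 1"] assms by simp

lemma psd_on_pair:
  assumes "psd_on S A" "finite S" "p \<in> S" "q \<in> S" "p \<noteq> q"
  shows "A p p * u * cnj u + A p q * v * cnj u + A q p * u * cnj v + A q q * v * cnj v \<in> \<real>\<^sub>\<ge>\<^sub>0"
  using psd_onD[OF psd_on_subset[OF assms(1), of "{p, q}"], of "\<lambda>r. if r = p then u else v"] assms
  by (simp add: algebra_simps)

lemma psd_on_hermitian:
  assumes "psd_on S A" "finite S" "p \<in> S" "q \<in> S"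
  shows "A p q = cnj (A q p)"
proof (cases "p = q")
  case True
  then show ?thesis
    using psd_on_diagonal[OF assms(1-3)] by (simp add: complex_nonneg_Reals_iff complex_eq_iff)
next
  case False
  note pair = psd_on_pair[OF assms False]
  have "Im (A p p) = 0" "Im (A q q) = 0"
    using psd_on_diagonal[OF assms(1,2)] assms(3,4) by (auto simp: complex_nonneg_Reals_iff)
  then show ?thesis
    using pair[of 1 1] pair[of 1 \<i>] by (simp add: complex_nonneg_Reals_iff complex_eq_iff)
qed

text \<open>
  Otherwise the form on \<open>{x, p}\<close>, being affine in the coefficient at \<open>x\<close>, would be unbounded below.
\<close>

lemma psd_on_zero_diagonal:
  assumes "psd_on S A" "finite S" "x \<in> S" "p \<in> S" "A x x = 0"
  shows "A x p = 0"
proof (rule ccontr)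
  assume nz: "A x p \<noteq> 0"
  then have "x \<noteq> p" using assms by auto
  \<comment> \<open>With coefficients \<open>- k * A x p\<close> at \<open>x\<close> and \<open>1\<close> at \<open>p\<close> the form equals \<open>A p p - 2 k N\<close>;
    \<open>k\<close> is chosen to make this \<open>-1\<close>.\<close>
  define N where "N = (cmod (A x p))\<^sup>2"
  define k where "k = (Re (A p p) + 1) / (2 * N)"
  have N: "N > 0" using nz by (simp add: N_def)
  have "A x x * (- of_real k * A x p) * cnj (- of_real k * A x p) + A x p * 1 * cnj (- of_real k * A x p)
        + A p x * (- of_real k * A x p) * cnj 1 + A p p * 1 * cnj 1
       = A p p - 2 * of_real k * (A x p * cnj (A x p))"
    using psd_on_hermitian[OF assms(1,2,4,3)] assms(5) by (simp add: algebra_simps)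
  also have "A x p * cnj (A x p) = of_real N"
    by (simp only: N_def complex_norm_square)
  finally have "A p p - 2 * of_real k * of_real N \<in> \<real>\<^sub>\<ge>\<^sub>0"
    using psd_on_pair[OF assms(1-4) \<open>x \<noteq> p\<close>, of "- of_real k * A x p" 1] by metis
  then have "Re (A p p) - 2 * k * N \<ge> 0" by (simp add: complex_nonneg_Reals_iff)
  moreover have "2 * k * N = Re (A p p) + 1" using N by (simp add: k_def)
  ultimately show False by simp
qed

text \<open>
  The form of the Schur complement is the minimum of the form of \<open>A\<close> over the coefficient at \<open>x\<close>.
  If \<open>A x x = 0\<close>, the quotient is \<open>0\<close> by the convention for division by zero and the claim
  reduces to restriction to \<open>S\<close>.
\<close>

lemma psd_on_schur_complement:
  assumes psd: "psd_on (insert x S) A" and fin: "finite S" and x: "x \<notin> S"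
  shows "psd_on S (\<lambda>p q. A p q - A p x * A x q / A x x)"
proof (cases "A x x = 0")
  case True
  then show ?thesis using psd_on_subset[OF psd, of S] fin by auto
next
  case False
  define a where "a = A x x"
  have a: "a \<noteq> 0" "cnj a = a"
    using False psd_on_hermitian[OF psd, of x x] fin by (auto simp: a_def)
  show ?thesis unfolding psd_on_def
  proof
    fix c
    define s where "s = (\<Sum>q\<in>S. A x q * c q)"
    have s': "(\<Sum>p\<in>S. A p x * cnj (c p)) = cnj s"
      unfolding s_def cnj_sum using psd_on_hermitian[OF psd, of _ x] fin by (intro sum.cong) auto
    \<comment> \<open>Completing the square: the value \<open>- s / a\<close> at \<open>x\<close> minimises the form of \<open>A\<close>.\<close>
    define d where "d = c(x := - s / a)"
    have d: "d x = - s / a" "\<And>p. p \<in> S \<Longrightarrow> d p = c p" using x by (auto simp: d_def)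
    have "(\<Sum>p\<in>insert x S. \<Sum>q\<in>insert x S. A p q * d q * cnj (d p))
      = a * (d x * cnj (d x)) + (\<Sum>q\<in>S. A x q * c q) * cnj (d x)
        + (\<Sum>p\<in>S. A p x * cnj (c p)) * d x + (\<Sum>p\<in>S. \<Sum>q\<in>S. A p q * c q * cnj (c p))"
      using fin x d(2) by (simp add: sum.distrib sum_distrib_left sum_distrib_right a_def mult_ac)
    also have "\<dots> = (\<Sum>p\<in>S. \<Sum>q\<in>S. A p q * c q * cnj (c p)) - cnj s * s / a"
      using a unfolding s' s_def[symmetric] d(1) by (simp add: field_simps)
    also have "cnj s * s / a = (\<Sum>p\<in>S. \<Sum>q\<in>S. A p x * A x q / A x x * c q * cnj (c p))"
      unfolding s'[symmetric] unfolding s_def a_def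
      by (simp only: sum_product sum_divide_distrib) (simp add: mult_ac)
    finally show "(\<Sum>p\<in>S. \<Sum>q\<in>S. (A p q - A p x * A x q / A x x) * c q * cnj (c p)) \<in> \<real>\<^sub>\<ge>\<^sub>0"
      using psd_onD[OF psd, of d] by (simp add: sum_subtractf left_diff_distrib)
  qed
qed

text \<open>
  Schur's product theorem, by splitting off one index at a time: \<open>A\<close> is the sum of its Schur
  complement, to which the induction hypothesis applies, and of a matrix of rank one, whose
  entrywise product with \<open>B\<close> merely rescales the coefficients in the form of \<open>B\<close>.
\<close>

lemma psd_on_schur_product:
  assumes "finite S" "psd_on S A" "psd_on S B"
  shows "psd_on S (\<lambda>p q. A p q * B p q)"
  using assms
proof (induction S arbitrary: A rule: finite_induct)
  case empty
  then show ?case by (simp add: psd_on_def)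
next
  case (insert x S)
  note A = insert.prems(1) and B = insert.prems(2)
  have fin: "finite (insert x S)" using insert.hyps by simp
  define R where "R p q = A p q - A p x * A x q / A x x" for p q
  have "psd_on S (\<lambda>p q. R p q * B p q)"
    unfolding R_def
    by (rule insert.IH[OF psd_on_schur_complement[OF A insert.hyps]])
       (rule psd_on_subset[OF B _ fin], auto)
  show ?case unfolding psd_on_def
  proof
    fix c
    have zero: "A x p = 0" "A p x = 0" if "A x x = 0" "p \<in> insert x S" for p
      using psd_on_zero_diagonal[OF A fin _ that(2,1)] psd_on_hermitian[OF A fin that(2), of x]
      by auto
    \<comment> \<open>The remainder has a vanishing row and column at \<open>x\<close>, also in the degenerate case \<open>A x x = 0\<close>.\<close>
    have R0: "R x p = 0" "R p x = 0" if "p \<in> insert x S" for p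
      using zero[OF _ that] by (auto simp: R_def)
    define d where "d p = A x p * c p" for p
    have d': "cnj (d p) = A p x * cnj (c p)" if "p \<in> insert x S" for p
      using psd_on_hermitian[OF A fin that, of x] by (simp add: d_def)
    have "(\<Sum>p\<in>insert x S. \<Sum>q\<in>insert x S. A p q * B p q * c q * cnj (c p))
       = (\<Sum>p\<in>insert x S. \<Sum>q\<in>insert x S. R p q * B p q * c q * cnj (c p)
             + B p q * d q * cnj (d p) / A x x)"
      by (intro sum.cong refl) (simp only: d', simp add: R_def d_def algebra_simps)
    also have "\<dots> = (\<Sum>p\<in>insert x S. \<Sum>q\<in>insert x S. R p q * B p q * c q * cnj (c p))
        + (\<Sum>p\<in>insert x S. \<Sum>q\<in>insert x S. B p q * d q * cnj (d p)) / A x x"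
      by (simp only: sum.distrib sum_divide_distrib)
    also have "(\<Sum>p\<in>insert x S. \<Sum>q\<in>insert x S. R p q * B p q * c q * cnj (c p))
       = (\<Sum>p\<in>S. \<Sum>q\<in>S. R p q * B p q * c q * cnj (c p))"
      using insert.hyps R0 by simp
    finally show "(\<Sum>p\<in>insert x S. \<Sum>q\<in>insert x S. A p q * B p q * c q * cnj (c p)) \<in> \<real>\<^sub>\<ge>\<^sub>0"
      using psd_onD[OF \<open>psd_on S (\<lambda>p q. R p q * B p q)\<close>, of c] psd_onD[OF B, of d]
        psd_on_diagonal[OF A fin, of x]
      by (simp only: nonneg_Reals_add_I nonneg_Reals_divide_I insertI1)
  qed
qed

text \<open>
  Transfers the kernel property, which speaks of points indexed by an initial segment of the
  natural numbers, to an arbitrary finite index set.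
\<close>

lemma scalar_kernel_psd_on:
  fixes f :: "'i \<Rightarrow> 'a"
  assumes K: "nonneg_definite_scalar_kernel_on \<Omega> K" and fin: "finite S"
    and f: "\<And>p. p \<in> S \<Longrightarrow> f p \<in> \<Omega>"
  shows "psd_on S (\<lambda>p q. K (f p) (f q))"
  unfolding psd_on_def
proof
  fix c :: "'i \<Rightarrow> complex"
  obtain e where e: "bij_betw e {..<card S} S"
    using ex_bij_betw_nat_finite[OF fin] by (auto simp: atLeast0LessThan)
  have "f (e p) \<in> \<Omega>" if "p < card S" for p
    using bij_betwE[OF e] f that by auto
  then have "(\<Sum>p<card S. \<Sum>q<card S. hermitian_inner
        ((mat (K (f (e p)) (f (e q))) :: complex ^ 1 ^ 1) *v (\<chi> _. c (e q))) (\<chi> _. c (e p))) \<in> \<real>\<^sub>\<ge>\<^sub>0"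
    using K[unfolded nonneg_definite_scalar_kernel_on_def nonneg_definite_kernel_on_def,
        rule_format, of "card S" "\<lambda>p. f (e p)" "\<lambda>q. \<chi> _. c (e q)"] by simp
  also have "(\<Sum>p<card S. \<Sum>q<card S. hermitian_inner
        ((mat (K (f (e p)) (f (e q))) :: complex ^ 1 ^ 1) *v (\<chi> _. c (e q))) (\<chi> _. c (e p)))
     = (\<Sum>p<card S. \<Sum>q<card S. K (f (e p)) (f (e q)) * c (e q) * cnj (c (e p)))"
    by (simp add: hermitian_inner_def matrix_vector_mult_def mat_def)
  also have "\<dots> = (\<Sum>p\<in>S. \<Sum>q\<in>S. K (f p) (f q) * c q * cnj (c p))"
    by (subst (1 2) sum.reindex_bij_betw[OF e, symmetric]) (rule refl)
  finally show "(\<Sum>p\<in>S. \<Sum>q\<in>S. K (f p) (f q) * c q * cnj (c p)) \<in> \<real>\<^sub>\<ge>\<^sub>0" .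
qed

section \<open>Second differences of separately holomorphic functions\<close>

lemma holomorphic_deriv_bound:
  assumes "f holomorphic_on ball 0 r" "r > 0" and "\<And>z. z \<in> ball 0 r \<Longrightarrow> cmod (f z) \<le> M"
    and "cmod z < r / 2"
  shows "cmod ((deriv ^^ n) f z) \<le> fact n * M / (r / 2) ^ n"
proof (rule Cauchy_inequality)
  have sub: "cball z (r/2) \<subseteq> ball 0 r"
  proof
    fix x assume "x \<in> cball z (r/2)"
    then have "cmod x \<le> cmod z + r/2"
      using norm_triangle_ineq4[of z "z - x"] by (simp add: dist_norm)
    then show "x \<in> ball 0 r" using assms(4) by simp
  qed
  then show "f holomorphic_on ball z (r/2)"
    using assms(1) ball_subset_cball holomorphic_on_subset by blast
  show "continuous_on (cball z (r/2)) f"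
    using assms(1) sub holomorphic_on_imp_continuous_on continuous_on_subset by blast
  show "cmod (f x) \<le> M" if "cmod (z - x) = r/2" for x
    using that sub assms(3) by (auto simp: dist_norm subset_iff)
qed (use assms in auto)

text \<open>
  Taylor's theorem with the derivatives bounded by Cauchy's inequality. Only the supremum \<open>M\<close> enters
  the error terms, so the estimates are uniform over bounded families of holomorphic functions.
\<close>

lemma holomorphic_Taylor_bounds:
  assumes "f holomorphic_on ball 0 r" "r > 0" and "\<And>z. z \<in> ball 0 r \<Longrightarrow> cmod (f z) \<le> M"
    and "cmod h < r / 2"
  shows "cmod (f h - f 0) \<le> 2 * M / r * cmod h"
    and "cmod (f h - f 0 - h * deriv f 0) \<le> 8 * M / r\<^sup>2 * (cmod h)\<^sup>2"
proof -
  have der: "((deriv ^^ i) f has_field_derivative (deriv ^^ Suc i) f x) (at x within ball 0 (r/2))"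
    if "x \<in> ball 0 (r/2)" for i x
  proof -
    have "(deriv ^^ i) f holomorphic_on ball 0 r"
      using assms(1) by (intro holomorphic_higher_deriv) auto
    moreover have "x \<in> ball 0 r" using that assms(2) by auto
    ultimately show ?thesis
      by (auto intro: holomorphic_derivI has_field_derivative_at_within)
  qed
  have h: "h \<in> ball 0 (r/2)" "0 \<in> ball 0 (r/2)" using assms by auto
  have b: "cmod ((deriv ^^ Suc n) f x) \<le> fact (Suc n) * M / (r / 2) ^ Suc n"
    if "x \<in> ball 0 (r/2)" for x n
    using holomorphic_deriv_bound[OF assms(1-3), of x "Suc n"] that by simp
  show "cmod (f h - f 0) \<le> 2 * M / r * cmod h"
    using complex_Taylor[OF convex_ball der b[of _ 0] h(2) h(1)] by (simp add: mult_ac)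
  have "8 * M / r\<^sup>2 * (cmod h)\<^sup>2 = fact (Suc 1) * M / (r / 2) ^ Suc 1 * cmod (h - 0) ^ Suc 1 / fact 1"
    by (simp add: power2_eq_square field_simps)
  then show "cmod (f h - f 0 - h * deriv f 0) \<le> 8 * M / r\<^sup>2 * (cmod h)\<^sup>2"
    using complex_Taylor[OF convex_ball der b[of _ 1] h(2) h(1)] by (simp add: algebra_simps)
qed

text \<open>
  The difference quotients in the second variable are holomorphic in the first one and, by the
  uniform second-order Taylor bound, converge uniformly to the derivative.
\<close>

lemma holomorphic_on_deriv_parameter:
  fixes G :: "complex \<Rightarrow> complex \<Rightarrow> complex"
  assumes r: "r > 0"
    and hol1: "\<And>t. t \<in> ball 0 r \<Longrightarrow> (\<lambda>s. G s t) holomorphic_on ball 0 r"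
    and hol2: "\<And>s. s \<in> ball 0 r \<Longrightarrow> G s holomorphic_on ball 0 r"
    and bd: "\<And>s t. s \<in> ball 0 r \<Longrightarrow> t \<in> ball 0 r \<Longrightarrow> cmod (G s t) \<le> M"
  shows "(\<lambda>s. deriv (G s) 0) holomorphic_on ball 0 r"
proof (rule holomorphic_uniform_sequence)
  \<comment> \<open>A null sequence of nonzero steps of modulus below \<open>r / 2\<close>, the range of the Taylor bounds.\<close>
  define h where "h n = complex_of_real (r / (3 + real n))" for n
  have h: "h n \<noteq> 0" "cmod (h n) < r / 2" for n
  proof -
    have "0 < 3 + real n" by simp
    then show "h n \<noteq> 0" using r unfolding h_def of_real_eq_0_iff by auto
    have "r / (3 + real n) \<le> r / 3" using r by (intro divide_left_mono) auto
    then moreover have "0 < r / (3 + real n)" using r by simp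
    ultimately show "cmod (h n) < r / 2" using r unfolding h_def norm_of_real by linarith
  qed
  have h': "h n \<in> ball 0 r" for n using h[of n] r by simp
  show "(\<lambda>s. (G s (h n) - G s 0) / h n) holomorphic_on ball 0 r" for n
    using hol1[OF h'[of n]] hol1[of 0] r h(1) by (intro holomorphic_intros) auto
  fix x :: complex assume x: "x \<in> ball 0 r"
  then obtain d where d: "d > 0" "cball x d \<subseteq> ball 0 r"
    using open_contains_cball_eq[OF open_ball] by blast
  have est: "cmod ((G s (h n) - G s 0) / h n - deriv (G s) 0) \<le> 8 * M / r\<^sup>2 * cmod (h n)"
    if s: "s \<in> ball 0 r" for s n
  proof -
    have "(G s (h n) - G s 0) / h n - deriv (G s) 0 = (G s (h n) - G s 0 - h n * deriv (G s) 0) / h n"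
      using h(1)[of n] by (simp add: field_simps)
    then have "cmod ((G s (h n) - G s 0) / h n - deriv (G s) 0)
        \<le> 8 * M / r\<^sup>2 * (cmod (h n))\<^sup>2 / cmod (h n)"
      using holomorphic_Taylor_bounds(2)[OF hol2[OF s] r bd[OF s] h(2)[of n]]
      by (simp only: norm_divide divide_right_mono norm_ge_zero)
    then show ?thesis using h(1)[of n] by (simp add: power2_eq_square)
  qed
  have "(\<lambda>n. r / (3 + real n)) \<longlonglongrightarrow> 0"
    by (intro tendsto_divide_0[OF tendsto_const] filterlim_at_top_imp_at_infinity
        filterlim_tendsto_add_at_top[OF tendsto_const] filterlim_real_sequentially)
  then have "h \<longlonglongrightarrow> 0"
    unfolding h_def using tendsto_of_real[where 'a = complex] by (metis of_real_0)
  then have h0: "(\<lambda>n. 8 * M / r\<^sup>2 * cmod (h n)) \<longlonglongrightarrow> 0"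
    by (intro tendsto_mult_right_zero tendsto_norm_zero)
  have "uniform_limit (cball x d) (\<lambda>n s. (G s (h n) - G s 0) / h n) (\<lambda>s. deriv (G s) 0) sequentially"
    unfolding uniform_limit_iff
  proof (intro allI impI)
    fix e :: real assume "e > 0"
    then have "\<forall>\<^sub>F n in sequentially. 8 * M / r\<^sup>2 * cmod (h n) < e"
      by (rule order_tendstoD(2)[OF h0])
    then show "\<forall>\<^sub>F n in sequentially. \<forall>s\<in>cball x d. dist ((G s (h n) - G s 0) / h n) (deriv (G s) 0) < e"
    proof eventually_elim
      case (elim n)
      show ?case unfolding dist_norm using est d(2) elim by (blast intro: order_le_less_trans)
    qed
  qed
  then show "\<exists>d>0. cball x d \<subseteq> ball 0 r \<and>
      uniform_limit (cball x d) (\<lambda>n s. (G s (h n) - G s 0) / h n) (\<lambda>s. deriv (G s) 0) sequentially"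
    using d by blast
qed auto

text \<open>
  The second difference is the increment over the step \<open>h\<close> in \<open>s\<close> of the first difference in \<open>t\<close>. The
  latter is \<open>h\<close> times the derivative in \<open>t\<close> plus a Taylor error, and a holomorphic error that is
  uniformly small has small increments as well, by Cauchy's estimate. This is how joint
  differentiability is bypassed.
\<close>

lemma mixed_second_difference_limit:
  fixes G :: "complex \<Rightarrow> complex \<Rightarrow> complex"
  assumes r: "r > 0"
    and hol1: "\<And>t. t \<in> ball 0 r \<Longrightarrow> (\<lambda>s. G s t) holomorphic_on ball 0 r"
    and hol2: "\<And>s. s \<in> ball 0 r \<Longrightarrow> G s holomorphic_on ball 0 r"
    and bd: "\<And>s t. s \<in> ball 0 r \<Longrightarrow> t \<in> ball 0 r \<Longrightarrow> cmod (G s t) \<le> M"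
  shows "((\<lambda>h. (G h h - G h 0 - G 0 h + G 0 0) / h\<^sup>2) \<longlongrightarrow> deriv (\<lambda>s. deriv (G s) 0) 0) (at 0)"
proof -
  define g where "g s = deriv (G s) 0" for s
  have g: "g holomorphic_on ball 0 r"
    unfolding g_def by (rule holomorphic_on_deriv_parameter[OF assms])
  have lim: "((\<lambda>h. (g h - g 0) / h) \<longlongrightarrow> deriv g 0) (at 0)"
    using holomorphic_derivI[OF g open_ball, of 0] r by (simp only: has_field_derivative_iff) simp
  define E where "E h s = (G s h - G s 0) - h * g s" for h s
  have E: "E h holomorphic_on ball 0 r" if "cmod h < r" for h
    unfolding E_def using hol1[of h] hol1[of 0] g that r by (intro holomorphic_intros) auto
  have Ebd: "cmod (E h s) \<le> 8 * M / r\<^sup>2 * (cmod h)\<^sup>2" if "s \<in> ball 0 r" "cmod h < r/2" for h s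
    unfolding E_def g_def using holomorphic_Taylor_bounds(2)[OF hol2 r bd that(2)] that(1) by auto
  \<comment> \<open>As \<open>E h\<close> is uniformly \<open>O(h\<^sup>2)\<close>, its increments over a step \<open>h\<close> are \<open>O(h\<^sup>3)\<close>.\<close>
  have est: "cmod ((E h h - E h 0) / h\<^sup>2) \<le> 16 * M / r ^ 3 * cmod h" if "cmod h < r/2" "h \<noteq> 0" for h
  proof -
    have "cmod (E h h - E h 0) \<le> 2 * (8 * M / r\<^sup>2 * (cmod h)\<^sup>2) / r * cmod h"
      using that(1) r by (intro holomorphic_Taylor_bounds(1)[OF E r Ebd]) auto
    then show ?thesis
      using that r by (simp add: norm_divide norm_power divide_simps) 
        (simp add: power2_eq_square power3_eq_cube field_simps)
  qed
  have "((\<lambda>h. (E h h - E h 0) / h\<^sup>2) \<longlongrightarrow> 0) (at 0)"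
  proof (rule Lim_null_comparison)
    show "\<forall>\<^sub>F h in at 0. cmod ((E h h - E h 0) / h\<^sup>2) \<le> 16 * M / r ^ 3 * cmod h"
      unfolding eventually_at using est half_gt_zero[OF r] by (intro exI[of _ "r/2"]) auto
    show "((\<lambda>h. 16 * M / r ^ 3 * cmod h) \<longlongrightarrow> 0) (at (0::complex))"
      by (intro tendsto_mult_right_zero tendsto_norm_zero tendsto_ident_at)
  qed
  from tendsto_add[OF this lim]
  have "((\<lambda>h. (E h h - E h 0) / h\<^sup>2 + (g h - g 0) / h) \<longlongrightarrow> deriv g 0) (at 0)" by simp
  then have "((\<lambda>h. (G h h - G h 0 - G 0 h + G 0 0) / h\<^sup>2) \<longlongrightarrow> deriv g 0) (at 0)"
    by (rule Lim_transform_eventually)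
       (auto simp: eventually_at_filter E_def field_simps power2_eq_square intro!: always_eventually)
  then show ?thesis by (simp add: g_def[abs_def])
qed

text \<open>
  Near a point \<open>a\<close>, continuity keeps the imaginary part of \<open>f z - f a\<close> inside the principal strip, so
  \<open>f z = f a + Ln (g z / g a)\<close> there.
\<close>

lemma holomorphic_on_continuous_log:
  fixes f g :: "complex \<Rightarrow> complex"
  assumes "open S" and "continuous_on S f" and "g holomorphic_on S"
    and "\<And>z. z \<in> S \<Longrightarrow> exp (f z) = g z"
  shows "f holomorphic_on S"
  unfolding holomorphic_on_open[OF \<open>open S\<close>]
proof
  fix a assume a: "a \<in> S"
  have cont: "continuous (at a) f" using assms(1,2) a continuous_on_eq_continuous_at by blast
  have ga: "g a \<noteq> 0" using assms(4)[OF a] by (metis exp_not_eq_zero)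
  have g': "(g has_field_derivative deriv g a) (at a)"
    using holomorphic_derivI[OF assms(3,1) a] .
  have "((\<lambda>z. f a + Ln (g z / g a)) has_field_derivative (deriv g a / g a)) (at a)"
    using ga by (auto intro!: derivative_eq_intros g')
  moreover have "\<forall>\<^sub>F z in nhds a. f a + Ln (g z / g a) = f z"
  proof -
    have "(f \<longlongrightarrow> f a) (nhds a)"
      using cont by (simp add: isCont_def tendsto_nhds_iff)
    then have "\<forall>\<^sub>F z in nhds a. dist (f z) (f a) < pi"
      using tendstoD pi_gt_zero by blast
    moreover have "\<forall>\<^sub>F z in nhds a. z \<in> S" using assms(1) a by (rule eventually_nhds_in_open)
    ultimately show ?thesis
    proof eventually_elim
      case (elim z)
      have "\<bar>Im (f z - f a)\<bar> < pi"
        using abs_Im_le_cmod[of "f z - f a"] elim(1) by (simp only: dist_norm)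
      then have "Ln (exp (f z - f a)) = f z - f a" by (intro Ln_exp) auto
      then show ?case using assms(4)[OF a] assms(4)[OF elim(2)] by (simp add: exp_diff)
    qed
  qed
  ultimately have "(f has_field_derivative (deriv g a / g a)) (at a)"
    using DERIV_cong_ev[OF refl _ refl] by fast
  then show "\<exists>f'. (f has_field_derivative f') (at a)" by blast
qed

text \<open>
  For \<open>G\<close> a slice of \<open>log K\<close>, \<open>F\<close> is a slice of the kernel \<open>(K\<^sup>\<alpha> \<otimes> K\<^sup>\<beta>)((x, x'), (y, y')) = K\<^sup>\<alpha>(x, y) K\<^sup>\<beta>(x', y')\<close>, with both pairs moving
  along the direction \<open>(\<beta> e, - \<alpha> e)\<close>. This direction makes the first derivatives of the exponent
  vanish at the origin, so only its mixed second derivative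
  \<open>(\<alpha> \<beta>\<^sup>2 + \<beta> \<alpha>\<^sup>2) \<partial>\<^sub>s \<partial>\<^sub>t G\<close> contributes.
\<close>

lemma power_difference_limit:
  fixes G :: "complex \<Rightarrow> complex \<Rightarrow> complex" and \<alpha> \<beta> :: real
  assumes r: "r > 0"
    and hol1: "\<And>t. t \<in> ball 0 r \<Longrightarrow> (\<lambda>s. G s t) holomorphic_on ball 0 r"
    and hol2: "\<And>s. s \<in> ball 0 r \<Longrightarrow> G s holomorphic_on ball 0 r"
    and bd: "\<And>s t. s \<in> ball 0 r \<Longrightarrow> t \<in> ball 0 r \<Longrightarrow> cmod (G s t) \<le> M"
    and ab: "\<alpha> > 0" "\<beta> > 0"
  defines "F \<equiv> \<lambda>(s::complex) (t::complex). exp (of_real \<alpha> * G (of_real \<beta> * s) (of_real \<beta> * t) + of_real \<beta> * G (- of_real \<alpha> * s) (- of_real \<alpha> * t))"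
  shows "((\<lambda>h. (F h h - F h 0 - F 0 h + F 0 0) / h\<^sup>2) \<longlongrightarrow>
     of_real (\<alpha> * \<beta> * (\<alpha> + \<beta>)) * (exp (of_real (\<alpha> + \<beta>) * G 0 0) * deriv (\<lambda>s. deriv (G s) 0) 0)) (at 0)"
proof -
  \<comment> \<open>Small enough for multiplication by \<open>\<beta>\<close> and by \<open>- \<alpha>\<close> to map the ball of radius \<open>R\<close> into that of
    radius \<open>r\<close>.\<close>
  define R where "R = r / (1 + \<alpha> + \<beta>)"
  have R: "R > 0" using r ab by (simp add: R_def)
  have scale: "c * s \<in> ball 0 r" if "s \<in> ball 0 R" "cmod c \<le> \<alpha> + \<beta>" for c s
  proof -
    have "cmod c * cmod s \<le> (\<alpha> + \<beta>) * cmod s" using that(2) by (rule mult_right_mono) simp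
    also have "\<dots> \<le> (1 + \<alpha> + \<beta>) * cmod s" by (intro mult_right_mono) auto
    also have "\<dots> < (1 + \<alpha> + \<beta>) * R" using that(1) ab by (intro mult_strict_left_mono) auto
    also have "\<dots> = r" using ab by (simp add: R_def)
    finally show ?thesis by (simp add: norm_mult)
  qed
  have sc: "of_real \<beta> * s \<in> ball 0 r" "- of_real \<alpha> * s \<in> ball 0 r" if "s \<in> ball 0 R" for s :: complex
    using scale[OF that] ab by auto
  have lin: "(\<lambda>s. f (c * s)) holomorphic_on ball 0 R"
    if "f holomorphic_on ball 0 r" "cmod c \<le> \<alpha> + \<beta>" for f c
    using holomorphic_on_compose_gen[of "\<lambda>s. c * s" "ball 0 R", OF _ that(1)] scale[OF _ that(2)]
    by (simp add: o_def image_subset_iff holomorphic_on_mult)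
  have ab': "cmod (of_real \<beta>) \<le> \<alpha> + \<beta>" "cmod (- of_real \<alpha>) \<le> \<alpha> + \<beta>" using ab by auto
  have F1: "(\<lambda>s. F s t) holomorphic_on ball 0 R" if "t \<in> ball 0 R" for t
    unfolding F_def
    by (intro holomorphic_intros lin[OF hol1[OF sc(1)[OF that]] ab'(1)] lin[OF hol1[OF sc(2)[OF that]] ab'(2)])
  have F2: "F s holomorphic_on ball 0 R" if "s \<in> ball 0 R" for s
    unfolding F_def
    by (intro holomorphic_intros lin[OF hol2[OF sc(1)[OF that]] ab'(1)] lin[OF hol2[OF sc(2)[OF that]] ab'(2)])
  have Fbd: "cmod (F s t) \<le> exp (\<alpha> * M + \<beta> * M)" if "s \<in> ball 0 R" "t \<in> ball 0 R" for s t
  proof -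
    have "cmod (F s t) \<le> exp (cmod (of_real \<alpha> * G (of_real \<beta> * s) (of_real \<beta> * t) + of_real \<beta> * G (- of_real \<alpha> * s) (- of_real \<alpha> * t)))"
      unfolding F_def by (rule norm_exp)
    also have "cmod (of_real \<alpha> * G (of_real \<beta> * s) (of_real \<beta> * t) + of_real \<beta> * G (- of_real \<alpha> * s) (- of_real \<alpha> * t))
        \<le> cmod (of_real \<alpha> * G (of_real \<beta> * s) (of_real \<beta> * t)) + cmod (of_real \<beta> * G (- of_real \<alpha> * s) (- of_real \<alpha> * t))"
      by (rule norm_triangle_ineq)
    also have "\<dots> \<le> \<alpha> * M + \<beta> * M"
      unfolding norm_mult using sc that ab by (intro add_mono mult_mono bd) auto
    finally show ?thesis by simp
  qed
  define D where "D s = deriv (G s) 0" for s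
  have D: "D holomorphic_on ball 0 r"
    unfolding D_def by (rule holomorphic_on_deriv_parameter[OF r hol1 hol2 bd])
  have G': "((\<lambda>t. G s (c * t)) has_field_derivative D s * c) (at 0)" if "s \<in> ball 0 r" for s c
  proof -
    have "(G s has_field_derivative D s) (at (c * 0))"
      unfolding D_def using holomorphic_derivI[OF hol2[OF that] open_ball, of 0] r by simp
    from DERIV_chain2[OF this DERIV_cmult_Id] show ?thesis .
  qed
  have dF: "deriv (F s) 0 = F s 0 * (of_real \<alpha> * of_real \<beta> * (D (of_real \<beta> * s) - D (- of_real \<alpha> * s)))" if "s \<in> ball 0 R" for s
  proof -
    have "((\<lambda>t. of_real \<alpha> * G (of_real \<beta> * s) (of_real \<beta> * t)
              + of_real \<beta> * G (- of_real \<alpha> * s) (- of_real \<alpha> * t)) has_field_derivative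
        of_real \<alpha> * (D (of_real \<beta> * s) * of_real \<beta>)
              + of_real \<beta> * (D (- of_real \<alpha> * s) * (- of_real \<alpha>))) (at 0)"
      by (intro DERIV_add DERIV_cmult G' sc that)
    from DERIV_chain2[OF DERIV_exp this] have "(F s has_field_derivative
        F s 0 * (of_real \<alpha> * (D (of_real \<beta> * s) * of_real \<beta>)
              + of_real \<beta> * (D (- of_real \<alpha> * s) * (- of_real \<alpha>)))) (at 0)"
      by (simp only: F_def)
    then show ?thesis by (subst DERIV_imp_deriv) (auto simp: algebra_simps)
  qed
  have D': "((\<lambda>s. D (c * s)) has_field_derivative deriv D 0 * c) (at 0)" for c
  proof -
    have "(D has_field_derivative deriv D 0) (at (c * 0))"
      using holomorphic_derivI[OF D open_ball, of 0] r by simp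
    from DERIV_chain2[OF this DERIV_cmult_Id] show ?thesis .
  qed
  have F0: "((\<lambda>s. F s 0) has_field_derivative deriv (\<lambda>s. F s 0) 0) (at 0)"
    using R by (intro holomorphic_derivI[OF F1 open_ball]) auto
  \<comment> \<open>The second factor vanishes at \<open>s = 0\<close>, so the derivative of \<open>F s 0\<close> drops out.\<close>
  have "((\<lambda>s. F s 0 * (of_real \<alpha> * of_real \<beta> * (D (of_real \<beta> * s) - D (- of_real \<alpha> * s)))) has_field_derivative
      of_real (\<alpha> * \<beta> * (\<alpha> + \<beta>)) * (F 0 0 * deriv D 0)) (at 0)"
    using DERIV_mult[OF F0 DERIV_cmult[OF DERIV_diff[OF D'[of "of_real \<beta>"] D'[of "- of_real \<alpha>"]],
        of "of_real \<alpha> * of_real \<beta>"]]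
    by (simp add: algebra_simps)
  then have "((\<lambda>s. deriv (F s) 0) has_field_derivative of_real (\<alpha> * \<beta> * (\<alpha> + \<beta>)) * (F 0 0 * deriv D 0)) (at 0)"
    using R dF by (subst DERIV_cong_ev[OF refl _ refl, where g = "\<lambda>s. F s 0 * (of_real \<alpha> * of_real \<beta> * (D (of_real \<beta> * s) - D (- of_real \<alpha> * s)))"])
      (auto simp: eventually_nhds intro!: exI[of _ "ball 0 R"])
  then have "deriv (\<lambda>s. deriv (F s) 0) 0 = of_real (\<alpha> * \<beta> * (\<alpha> + \<beta>)) * (F 0 0 * deriv D 0)"
    by (rule DERIV_imp_deriv)
  moreover have "F 0 0 = exp (of_real (\<alpha> + \<beta>) * G 0 0)"
    by (simp add: F_def algebra_simps)
  ultimately show ?thesis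
    using mixed_second_difference_limit[OF R F1 F2 Fbd] by (simp add: D_def[abs_def])
qed

section \<open>Wirtinger derivatives and axis slices\<close>

lemma bounded_linear_axis: "bounded_linear (axis i :: complex \<Rightarrow> complex ^ 'm)"
  by (intro linear_conv_bounded_linear[THEN iffD1] linearI) (auto simp: axis_def vec_eq_iff)

text \<open>
  Along a coordinate axis the two Wirtinger operators are ordinary complex derivatives. For the
  conjugate one the axis is parametrised by \<open>cnj t\<close>, which turns anti-holomorphic functions into
  holomorphic ones.
\<close>

lemma wirtinger_eqI:
  assumes "((\<lambda>s. f (z + axis i s)) has_field_derivative D) (at 0)"
  shows "wirtinger i f z = D"
proof -
  have "((\<lambda>t. f (z + axis i (c * complex_of_real t))) has_vector_derivative c * D) (at 0)" for c
  proof -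
    have "((\<lambda>t. c * complex_of_real t) has_vector_derivative c * 1) (at 0)"
      unfolding has_vector_derivative_def
      by (auto intro!: derivative_eq_intros simp: scaleR_conv_of_real mult.commute)
    from field_vector_diff_chain_at[OF this, of "\<lambda>s. f (z + axis i s)" D]
    show ?thesis using assms by (simp add: o_def)
  qed
  from vector_derivative_at[OF this[of 1]] vector_derivative_at[OF this[of \<i>]]
  show ?thesis by (simp add: wirtinger_def partial_re_def partial_im_def flip: mult.assoc)
qed

lemma wirtinger_bar_eqI:
  assumes "((\<lambda>t. f (w + axis j (cnj t))) has_field_derivative D) (at 0)"
  shows "wirtinger_bar j f w = D"
proof -
  have "((\<lambda>t. f (w + axis j (cnj c * complex_of_real t))) has_vector_derivative c * D) (at 0)" for c
  proof -
    have "((\<lambda>t. c * complex_of_real t) has_vector_derivative c * 1) (at 0)"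
      unfolding has_vector_derivative_def
      by (auto intro!: derivative_eq_intros simp: scaleR_conv_of_real mult.commute)
    from field_vector_diff_chain_at[OF this, of "\<lambda>t. f (w + axis j (cnj t))" D]
    show ?thesis using assms by (simp add: o_def)
  qed
  \<comment> \<open>The imaginary direction is \<open>cnj c = \<i>\<close>, that is \<open>c = - \<i>\<close>.\<close>
  from vector_derivative_at[OF this[of 1]] vector_derivative_at[OF this[of "- \<i>"]]
  show ?thesis by (simp add: wirtinger_bar_def partial_re_def partial_im_def flip: mult.assoc)
qed

lemma open_axis_slice:
  fixes \<Omega> :: "(complex ^ 'm) set"
  assumes "open \<Omega>"
  shows "open {s. z + axis i s \<in> \<Omega>}" "open {t. w + axis j (cnj t) \<in> \<Omega>}"
proof -
  have "open ((\<lambda>s. z + axis i s) -` \<Omega>)"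
    by (intro continuous_open_vimage assms)
       (auto intro!: continuous_intros bounded_linear.continuous[OF bounded_linear_axis])
  moreover have "open ((\<lambda>t. w + axis j (cnj t)) -` \<Omega>)"
    by (intro continuous_open_vimage assms)
       (auto intro!: continuous_intros bounded_linear.continuous[OF bounded_linear_axis])
  ultimately show "open {s. z + axis i s \<in> \<Omega>}" "open {t. w + axis j (cnj t) \<in> \<Omega>}"
    by (simp_all add: vimage_def)
qed

lemma holomorphic_axis_slice:
  assumes f: "holomorphic_vec_on f \<Omega>" and \<Omega>: "open \<Omega>"
  shows "(\<lambda>s. f (z + axis i s)) holomorphic_on {s. z + axis i s \<in> \<Omega>}"
  unfolding holomorphic_on_open[OF open_axis_slice(1)[OF \<Omega>]]
proof
  fix s assume "s \<in> {s. z + axis i s \<in> \<Omega>}"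
  then obtain D where D: "(f has_derivative D) (at (z + axis i s))" "\<And>c v. D (c *s v) = c * D v"
    using f by (auto simp: holomorphic_vec_on_def)
  have "((\<lambda>s. z + axis i s) has_derivative axis i) (at s)"
    by (auto intro!: derivative_eq_intros bounded_linear.has_derivative[OF bounded_linear_axis])
  from diff_chain_at[OF this D(1)]
  have "((\<lambda>s. f (z + axis i s)) has_derivative (\<lambda>x. D (axis i x))) (at s)"
    by (simp add: o_def)
  moreover have "(\<lambda>x. D (axis i x)) = (*) (D (axis i 1))"
  proof
    fix x
    have "axis i x = x *s axis i (1::complex)" by (simp add: axis_def vec_eq_iff)
    then show "D (axis i x) = D (axis i 1) * x" using D(2) by (simp add: mult.commute)
  qed
  ultimately show "\<exists>f'. ((\<lambda>s. f (z + axis i s)) has_field_derivative f') (at s)"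
    unfolding has_field_derivative_def by auto
qed

lemma antiholomorphic_axis_slice:
  assumes f: "antiholomorphic_vec_on f \<Omega>" and \<Omega>: "open \<Omega>"
  shows "(\<lambda>t. f (w + axis j (cnj t))) holomorphic_on {t. w + axis j (cnj t) \<in> \<Omega>}"
proof -
  have "(\<lambda>s. cnj (f (w + axis j s))) holomorphic_on {s. w + axis j s \<in> \<Omega>}"
    using holomorphic_axis_slice[OF f[unfolded antiholomorphic_vec_on_def] \<Omega>] .
  also have "{s. w + axis j s \<in> \<Omega>} = cnj ` {t. w + axis j (cnj t) \<in> \<Omega>}"
    by (auto simp: image_iff) (metis complex_cnj_cnj)
  finally have "cnj \<circ> (\<lambda>s. cnj (f (w + axis j s))) \<circ> cnj holomorphic_on {t. w + axis j (cnj t) \<in> \<Omega>}"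
    by (rule holomorphic_on_compose_cnj_cnj) (rule open_axis_slice(2)[OF \<Omega>])
  then show ?thesis by (simp add: o_def)
qed

text \<open>
  On a two-dimensional slice through \<open>(z, w)\<close> the logarithm satisfies the hypotheses of the limit
  lemmas: holomorphy in each variable comes from \<open>K\<close> and the continuity of the branch, the bound \<open>M\<close>
  from joint continuity at the centre.
\<close>

lemma log_kernel_slice:
  fixes \<Omega> :: "(complex ^ 'm) set" and i j :: 'm
  assumes \<Omega>: "open \<Omega>" and K: "sesqui_analytic_on \<Omega> K" and L: "continuous_log_branch_on \<Omega> K logK"
    and zw: "z \<in> \<Omega>" "w \<in> \<Omega>"
  defines "G \<equiv> \<lambda>s t. logK (z + axis i s) (w + axis j (cnj t))"
  obtains r M where "r > 0"
    and "\<And>t. t \<in> ball 0 r \<Longrightarrow> (\<lambda>s. G s t) holomorphic_on ball 0 r"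
    and "\<And>s. s \<in> ball 0 r \<Longrightarrow> G s holomorphic_on ball 0 r"
    and "\<And>s t. s \<in> ball 0 r \<Longrightarrow> t \<in> ball 0 r \<Longrightarrow> cmod (G s t) \<le> M"
proof -
  define U where "U = {s. z + axis i s \<in> \<Omega>}"
  define V where "V = {t. w + axis j (cnj t) \<in> \<Omega>}"
  have ax0: "z + axis i 0 = z" "w + axis j 0 = w" by simp_all
  have UV: "open U" "open V" "0 \<in> U" "0 \<in> V"
    using zw open_axis_slice[OF \<Omega>] by (simp_all add: U_def V_def ax0)
  have ax: "continuous_on A (\<lambda>x. axis k (f x))" if "continuous_on A f"
    for A :: "'x::topological_space set" and f :: "'x \<Rightarrow> complex" and k :: 'm
    using bounded_linear.continuous_on[OF bounded_linear_axis that] .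
  have "continuous_on (\<Omega> \<times> \<Omega>) (\<lambda>(z, w). logK z w)"
    using L by (simp add: continuous_log_branch_on_def)
  moreover have "continuous_on (U \<times> V) (\<lambda>p. (z + axis i (fst p), w + axis j (cnj (snd p))))"
    by (intro continuous_intros ax)
  moreover have "(\<lambda>p. (z + axis i (fst p), w + axis j (cnj (snd p)))) ` (U \<times> V) \<subseteq> \<Omega> \<times> \<Omega>"
    by (auto simp: U_def V_def)
  ultimately have cont: "continuous_on (U \<times> V) (\<lambda>p. G (fst p) (snd p))"
    using continuous_on_compose2 by (fastforce simp: G_def)
  have holU: "(\<lambda>s. G s t) holomorphic_on U" if "t \<in> V" for t
  proof (rule holomorphic_on_continuous_log[OF UV(1)])
    show "continuous_on U (\<lambda>s. G s t)"
      using continuous_on_compose2[OF cont, of U "\<lambda>s. (s, t)"] that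
      by (simp add: continuous_on_Pair image_subset_iff)
    show "(\<lambda>s. K (z + axis i s) (w + axis j (cnj t))) holomorphic_on U"
      unfolding U_def using K that \<Omega>
      by (intro holomorphic_axis_slice) (auto simp: sesqui_analytic_on_def V_def)
  qed (use L that in \<open>auto simp: continuous_log_branch_on_def G_def U_def V_def\<close>)
  have holV: "G s holomorphic_on V" if "s \<in> U" for s
  proof (rule holomorphic_on_continuous_log[OF UV(2)])
    show "continuous_on V (G s)"
      using continuous_on_compose2[OF cont, of V "\<lambda>t. (s, t)"] that
      by (simp add: continuous_on_Pair image_subset_iff)
    show "(\<lambda>t. K (z + axis i s) (w + axis j (cnj t))) holomorphic_on V"
      unfolding V_def using K that \<Omega>
      by (intro antiholomorphic_axis_slice) (auto simp: sesqui_analytic_on_def U_def)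
  qed (use L that in \<open>auto simp: continuous_log_branch_on_def G_def U_def V_def\<close>)
  have "isCont (\<lambda>p. G (fst p) (snd p)) (0, 0)"
    using cont UV by (intro continuous_on_interior) (auto simp: interior_Times interior_open)
  then obtain d where d: "d > 0" "\<And>p. dist p (0, 0) < d \<Longrightarrow> dist (G (fst p) (snd p)) (G 0 0) < 1"
    unfolding continuous_at_eps_delta by (metis fst_conv snd_conv zero_less_one)
  obtain e1 e2 where e: "e1 > 0" "ball 0 e1 \<subseteq> U" "e2 > 0" "ball 0 e2 \<subseteq> V"
    using UV open_contains_ball by metis
  define r where "r = min (d/2) (min e1 e2)"
  have r: "r > 0" "ball 0 r \<subseteq> U" "ball 0 r \<subseteq> V"
    using d e by (auto simp: r_def)
  show ?thesis
  proof (rule that[OF r(1)])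
    fix s t :: complex
    assume s: "s \<in> ball 0 r" and t: "t \<in> ball 0 r"
    have "dist (s, t) (0, 0) \<le> cmod s + cmod t"
      unfolding dist_norm using norm_Pair_le[of s t] by simp
    also have "\<dots> < d" using s t by (simp add: r_def)
    finally have "dist (G s t) (G 0 0) < 1" using d(2)[of "(s, t)"] by simp
    then show "cmod (G s t) \<le> cmod (G 0 0) + 1"
      unfolding dist_norm using norm_triangle_sub[of "G s t" "G 0 0"] by linarith
  qed (use holU holV r in \<open>blast intro: holomorphic_on_subset\<close>)+
qed

lemma mixed_derivative_eq_deriv_slice:
  assumes r: "r > 0"
    and hol1: "\<And>t. t \<in> ball 0 r \<Longrightarrow> (\<lambda>s. F (z + axis i s) (w + axis j (cnj t))) holomorphic_on ball 0 r"
    and hol2: "\<And>s. s \<in> ball 0 r \<Longrightarrow> (\<lambda>t. F (z + axis i s) (w + axis j (cnj t))) holomorphic_on ball 0 r"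
    and bd: "\<And>s t. s \<in> ball 0 r \<Longrightarrow> t \<in> ball 0 r \<Longrightarrow> cmod (F (z + axis i s) (w + axis j (cnj t))) \<le> M"
  shows "mixed_derivative i j F z w
    = deriv (\<lambda>s. deriv (\<lambda>t. F (z + axis i s) (w + axis j (cnj t))) 0) 0"
  unfolding mixed_derivative_def
proof (rule wirtinger_eqI)
  let ?D = "\<lambda>s. deriv (\<lambda>t. F (z + axis i s) (w + axis j (cnj t))) 0"
  have "?D holomorphic_on ball 0 r" by (rule holomorphic_on_deriv_parameter[OF r hol1 hol2 bd])
  then have "(?D has_field_derivative deriv ?D 0) (at 0)"
    using r by (intro holomorphic_derivI[OF _ open_ball]) auto
  moreover have "wirtinger_bar j (F (z + axis i s)) w = ?D s" if "s \<in> ball 0 r" for s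
    using r that by (intro wirtinger_bar_eqI holomorphic_derivI[OF hol2 open_ball]) auto
  ultimately show "((\<lambda>s. wirtinger_bar j (F (z + axis i s)) w) has_field_derivative deriv ?D 0) (at 0)"
    using r by (subst DERIV_cong_ev[OF refl _ refl, where g = ?D])
      (auto simp: eventually_nhds intro!: exI[of _ "ball 0 r"])
qed

section \<open>The curvature kernel\<close>

text \<open>
  Rearranges the quadratic form of a difference of vectors: each index \<open>x\<close> stands for the two
  points \<open>(x, True)\<close> (displaced) and \<open>(x, False)\<close> (base), and the four terms for each pair \<open>x, y\<close>
  become a second difference once the coefficients at \<open>(x, True)\<close> and \<open>(x, False)\<close> are opposite.
\<close>

lemma sum_signed_pairs:
  fixes g :: "'a \<times> bool \<Rightarrow> 'a \<times> bool \<Rightarrow> complex"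
  shows "(\<Sum>p\<in>S \<times> UNIV. \<Sum>q\<in>S \<times> UNIV. g p q) = (\<Sum>x\<in>S. \<Sum>y\<in>S.
    g (x, True) (y, True) + g (x, True) (y, False) + g (x, False) (y, True) + g (x, False) (y, False))"
  by (simp add: sum.cartesian_product' UNIV_bool sum.distrib add_ac)

theorem proposition2p3:
  fixes \<Omega> :: "(complex ^ 'm) set"
    and K logK :: "complex ^ 'm \<Rightarrow> complex ^ 'm \<Rightarrow> complex"
    and \<alpha> \<beta> :: real
  assumes "open \<Omega>" and "connected \<Omega>" and "\<Omega> \<noteq> {}" and "bounded \<Omega>"
    and "sesqui_analytic_on \<Omega> K"
    and "continuous_log_branch_on \<Omega> K logK"
    and "\<alpha> > 0" and "\<beta> > 0"
    and "nonneg_definite_scalar_kernel_on \<Omega> (kernel_power logK \<alpha>)"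
    and "nonneg_definite_scalar_kernel_on \<Omega> (kernel_power logK \<beta>)"
  shows "nonneg_definite_kernel_on \<Omega>
           (\<lambda>z w. (\<chi> i j. kernel_power logK (\<alpha> + \<beta>) z w * mixed_derivative i j logK z w)
                    :: complex ^ 'm ^ 'm)"
  unfolding nonneg_definite_kernel_on_def
proof (intro allI impI)
  fix n :: nat and z :: "nat \<Rightarrow> complex ^ 'm" and \<eta> :: "nat \<Rightarrow> complex ^ 'm"
  assume z: "\<forall>p<n. z p \<in> \<Omega>"
  \<comment> \<open>A point together with a coordinate direction is one index. The sum over
    coordinates thereby becomes part of the quadratic form, and every difference is taken along an axis.\<close>
  define S where "S = {..<n} \<times> (UNIV :: 'm set)"
  define v where "v x = \<eta> (fst x) $ snd x" for x
  define T where "T x y = kernel_power logK (\<alpha> + \<beta>) (z (fst x)) (z (fst y))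
      * mixed_derivative (snd x) (snd y) logK (z (fst x)) (z (fst y))" for x y
  define P where "P x c = z (fst x) + axis (snd x) c" for x c
  define F where "F x y s t = exp (of_real \<alpha> * logK (P x (of_real \<beta> * s)) (P y (cnj (of_real \<beta> * t)))
      + of_real \<beta> * logK (P x (- of_real \<alpha> * s)) (P y (cnj (- of_real \<alpha> * t))))" for x y s t
  define \<Delta> where "\<Delta> x y h = F x y h h - F x y h 0 - F x y 0 h + F x y 0 0" for x y h
  define C where "C = \<alpha> * \<beta> * (\<alpha> + \<beta>)"
  have C: "C > 0" using assms(7,8) by (simp add: C_def)
  have S: "finite S" by (simp add: S_def)
  have zS: "z (fst x) \<in> \<Omega>" if "x \<in> S" for x using z that by (auto simp: S_def)

  have P0: "P x 0 = z (fst x)" for x by (simp add: P_def)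

  have lim: "((\<lambda>h. \<Delta> x y h / h\<^sup>2) \<longlongrightarrow> of_real C * T x y) (at 0)" if x: "x \<in> S" and y: "y \<in> S" for x y
  proof -
    obtain r M where r: "r > 0"
      and hol1: "\<And>t. t \<in> ball 0 r \<Longrightarrow> (\<lambda>s. logK (P x s) (P y (cnj t))) holomorphic_on ball 0 r"
      and hol2: "\<And>s. s \<in> ball 0 r \<Longrightarrow> (\<lambda>t. logK (P x s) (P y (cnj t))) holomorphic_on ball 0 r"
      and bd: "\<And>s t. s \<in> ball 0 r \<Longrightarrow> t \<in> ball 0 r \<Longrightarrow> cmod (logK (P x s) (P y (cnj t))) \<le> M"
      unfolding P_def using log_kernel_slice[OF assms(1,5,6) zS[OF x] zS[OF y]] by metis
    have "mixed_derivative (snd x) (snd y) logK (z (fst x)) (z (fst y))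
        = deriv (\<lambda>s. deriv (\<lambda>t. logK (P x s) (P y (cnj t))) 0) 0"
      unfolding P_def
      by (rule mixed_derivative_eq_deriv_slice[OF r hol1[unfolded P_def] hol2[unfolded P_def] bd[unfolded P_def]])
    then have "T x y = exp (of_real (\<alpha> + \<beta>) * logK (P x 0) (P y (cnj 0)))
        * deriv (\<lambda>s. deriv (\<lambda>t. logK (P x s) (P y (cnj t))) 0) 0"
      by (simp add: T_def kernel_power_def P0)
    then show ?thesis
      using power_difference_limit[OF r hol1 hol2 bd assms(7,8)] by (simp only: \<Delta>_def F_def C_def)
  qed

  have psd: "(\<Sum>x\<in>S. \<Sum>y\<in>S. \<Delta> x y (of_real h) * v y * cnj (v x)) \<in> \<real>\<^sub>\<ge>\<^sub>0"
    if h: "\<And>x. x \<in> S \<Longrightarrow> P x (of_real \<beta> * of_real h) \<in> \<Omega> \<and> P x (- of_real \<alpha> * of_real h) \<in> \<Omega>" for h :: real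
  proof -
    define f where "f a p = P (fst p) (a * (if snd p then of_real h else 0))" for a and p :: "(nat \<times> 'm) \<times> bool"
    have f: "f (of_real \<beta>) p \<in> \<Omega>" "f (- of_real \<alpha>) p \<in> \<Omega>" if "p \<in> S \<times> UNIV" for p
      using h[of "fst p"] zS[of "fst p"] that by (auto simp: f_def P0)
    \<comment> \<open>Opposite coefficients at displaced and base points form the difference vectors.\<close>
    define c where "c p = (if snd p then v (fst p) else - v (fst p))" for p
    have "psd_on (S \<times> UNIV) (\<lambda>p q. kernel_power logK \<alpha> (f (of_real \<beta>) p) (f (of_real \<beta>) q)
        * kernel_power logK \<beta> (f (- of_real \<alpha>) p) (f (- of_real \<alpha>) q))"
      using S f by (intro psd_on_schur_product scalar_kernel_psd_on[OF assms(9)]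
          scalar_kernel_psd_on[OF assms(10)]) auto
    from psd_onD[OF this, of c] show ?thesis
      unfolding sum_signed_pairs
      by (simp add: c_def f_def kernel_power_def \<Delta>_def F_def exp_add algebra_simps)
  qed

  have near: "\<forall>\<^sub>F h in at_right 0. P x (a * of_real h) \<in> \<Omega>" if "x \<in> S" for x and a :: complex
  proof (rule topological_tendstoD)
    have "((\<lambda>h. z (fst x) + axis (snd x) (a * of_real h)) \<longlongrightarrow> z (fst x) + axis (snd x) (a * of_real 0)) (at_right 0)"
      by (intro tendsto_intros bounded_linear.tendsto[OF bounded_linear_axis])
    then show "((\<lambda>h. P x (a * of_real h)) \<longlongrightarrow> z (fst x)) (at_right 0)"
      by (simp only: P_def mult_zero_right of_real_0 P0[unfolded P_def])
  qed (use assms(1) zS that in auto)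
  have "\<forall>\<^sub>F h in at_right 0. \<forall>x\<in>S. P x (of_real \<beta> * of_real h) \<in> \<Omega> \<and> P x (- of_real \<alpha> * of_real h) \<in> \<Omega>"
    using near by (intro eventually_ball_finite S ballI eventually_conj)
  then have ev: "\<forall>\<^sub>F h in at_right 0.
      (\<Sum>x\<in>S. \<Sum>y\<in>S. \<Delta> x y (of_real h) / (of_real h)\<^sup>2 * v y * cnj (v x)) \<in> \<real>\<^sub>\<ge>\<^sub>0"
  proof eventually_elim
    case (elim h)
    have "(\<Sum>x\<in>S. \<Sum>y\<in>S. \<Delta> x y (of_real h) / (of_real h)\<^sup>2 * v y * cnj (v x))
      = (\<Sum>x\<in>S. \<Sum>y\<in>S. \<Delta> x y (of_real h) * v y * cnj (v x)) / of_real (h\<^sup>2)"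
      by (simp add: sum_divide_distrib)
    moreover have "of_real (h\<^sup>2) \<in> (\<real>\<^sub>\<ge>\<^sub>0 :: complex set)" by (simp only: nonneg_Reals_of_real_iff zero_le_power2)
    ultimately show ?case using psd[of h] elim by (simp only: nonneg_Reals_divide_I)
  qed
  have "filterlim (\<lambda>h. complex_of_real h) (at 0) (at_right 0)"
  proof (rule filterlim_atI)
    show "((\<lambda>h. complex_of_real h) \<longlongrightarrow> 0) (at_right 0)"
      using tendsto_of_real[OF tendsto_ident_at, of 0 "{0<..}", where 'a = complex] by simp
    show "\<forall>\<^sub>F h in at_right 0. complex_of_real h \<noteq> 0"
      using eventually_at_right_less[of "0::real"] by eventually_elim simp
  qed
  from filterlim_compose[OF lim this]
  have "((\<lambda>h. \<Sum>x\<in>S. \<Sum>y\<in>S. \<Delta> x y (of_real h) / (of_real h)\<^sup>2 * v y * cnj (v x))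
     \<longlongrightarrow> (\<Sum>x\<in>S. \<Sum>y\<in>S. of_real C * T x y * v y * cnj (v x))) (at_right 0)"
    by (intro tendsto_sum tendsto_mult tendsto_const)
  from Lim_in_closed_set[OF closed_nonneg_Reals_complex ev _ this]
  have "of_real C * (\<Sum>x\<in>S. \<Sum>y\<in>S. T x y * v y * cnj (v x)) \<in> \<real>\<^sub>\<ge>\<^sub>0"
    by (simp add: sum_distrib_left mult.assoc)
  then have "(\<Sum>x\<in>S. \<Sum>y\<in>S. T x y * v y * cnj (v x)) \<in> \<real>\<^sub>\<ge>\<^sub>0"
    using C by (auto simp: complex_nonneg_Reals_iff zero_le_mult_iff)
  also have "(\<Sum>x\<in>S. \<Sum>y\<in>S. T x y * v y * cnj (v x))
     = (\<Sum>p<n. \<Sum>i\<in>UNIV. \<Sum>q<n. \<Sum>j\<in>UNIV. T (p, i) (q, j) * v (q, j) * cnj (v (p, i)))"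
    by (simp add: S_def sum.cartesian_product')
  also have "\<dots> = (\<Sum>p<n. \<Sum>q<n. \<Sum>i\<in>UNIV. \<Sum>j\<in>UNIV. T (p, i) (q, j) * v (q, j) * cnj (v (p, i)))"
    by (intro sum.cong refl sum.swap)
  also have "\<dots> = (\<Sum>p<n. \<Sum>q<n. hermitian_inner
      ((\<chi> i j. kernel_power logK (\<alpha> + \<beta>) (z p) (z q) * mixed_derivative i j logK (z p) (z q)) *v \<eta> q) (\<eta> p))"
    by (simp add: hermitian_inner_def matrix_vector_mult_def T_def v_def sum_distrib_right)
  finally show "(\<Sum>p<n. \<Sum>q<n. hermitian_inner
      ((\<chi> i j. kernel_power logK (\<alpha> + \<beta>) (z p) (z q) * mixed_derivative i j logK (z p) (z q)) *v \<eta> q) (\<eta> p)) \<in> \<real>\<^sub>\<ge>\<^sub>0" .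
qed

end
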